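(* Let $d,m\ge1$. For $x_0\in\mathbb{R}^d$ and $A,G_1,\dots,G_m\in\mathbb{R}^{d\times d}$ put $\mathcal{A}:=A\oplus A+\sum_{k=1}^mG_k\otimes G_k\in\mathbb{R}^{d^2\times d^2}$ and $v:=\operatorname{vec}(x_0x_0^{\top})\in\mathbb{R}^{d^2}$. Let $S$ be the set of all $(x_0,A,\{G_k\}_{k=1}^m)\in\mathbb{R}^{d+(m+1)d^2}$ for which at least one of the two equalities $$\operatorname{rank}([x_0\,|\,Ax_0\,|\cdots|\,A^{d-1}x_0])=d,$$ $$\operatorname{rank}([v\,|\,\mathcal{A}v\,|\cdots|\,\mathcal{A}^{(d^2+d-2)/2}v])=(d^2+d)/2$$ fails. Then $S$ has Lebesgue measure zero in $\mathbb{R}^{d+(m+1)d^2}$.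
   Context: $\otimes$ is the Kronecker product, $\oplus$ the Kronecker sum, so $A\oplus A=A\otimes I_d+I_d\otimes A$, and $\operatorname{vec}(M)$ is the vector obtained by stacking the columns of $M$. $[\,\cdot\,|\cdots|\,\cdot\,]$ denotes horizontal concatenation of columns. A tuple $(x_0,A,G_1,\dots,G_m)$ with $x_0\in\mathbb{R}^d$ and $A,G_k\in\mathbb{R}^{d\times d}$ is identified with a point of $\mathbb{R}^{d+(m+1)d^2}$ via its entries. *)

theory Defs
  imports "HOL-Analysis.Analysis"
begin

(* The ordinary matrix power: the library's "A ^ k" on type real^'n^'n is the
   entrywise power, not the power with respect to "**". *)
primrec mat_pow :: "real^'n^'n \<Rightarrow> nat \<Rightarrow> real^'n^'n" where
  "mat_pow A 0 = mat 1"
| "mat_pow A (Suc k) = A ** mat_pow A k"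

(* Rows and columns of a Kronecker product are indexed by pairs, the index of the
   left factor being the leading (block) one. *)
definition kron :: "real^'n^'m \<Rightarrow> real^'q^'p \<Rightarrow> real^('n \<times> 'q)^('m \<times> 'p)"
    (infixl \<open>\<otimes>\<^sub>K\<close> 75) where
  "A \<otimes>\<^sub>K B = (\<chi> r c. A $ fst r $ fst c * B $ snd r $ snd c)"

definition kron_sum :: "real^'n^'n \<Rightarrow> real^'p^'p \<Rightarrow> real^('n \<times> 'p)^('n \<times> 'p)"
    (infixl \<open>\<oplus>\<^sub>K\<close> 70) where
  "A \<oplus>\<^sub>K B = A \<otimes>\<^sub>K mat 1 + mat 1 \<otimes>\<^sub>K B"

(* Column stacking: the leading component of the index is the column number,
   which fits the block order used for the Kronecker product. *)
definition vectorize :: "real^'n^'m \<Rightarrow> real^('n \<times> 'm)" where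
  "vectorize M = (\<chi> p. M $ snd p $ fst p)"

definition outer :: "real^'n \<Rightarrow> real^'n \<Rightarrow> real^'n^'n" where
  "outer x y = (columnvector x :: real^1^'n) ** (rowvector y :: real^'n^1)"

definition lifted_mat :: "real^'d^'d \<Rightarrow> real^'d^'d^'m \<Rightarrow> real^('d \<times> 'd)^('d \<times> 'd)" where
  "lifted_mat A G = A \<oplus>\<^sub>K A + (\<Sum>k\<in>UNIV. (G $ k) \<otimes>\<^sub>K (G $ k))"

(* The columns of [w | Bw | ... | B^r w]; r is the last exponent. *)
definition krylov :: "real^'n^'n \<Rightarrow> real^'n \<Rightarrow> nat \<Rightarrow> (real^'n) list" where
  "krylov B w r = map (\<lambda>k. mat_pow B k *v w) [0..<Suc r]"

(* The rank of the matrix with the given list of columns, as the dimension of its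
   column space. The number of columns depends on CARD('d) arithmetically and so is
   not available as an index type; whenever it is, this is the library's rank
   (lemma rank_eq_rank_of_columns). *)
definition rank_of_columns :: "(real^'n) list \<Rightarrow> nat" where
  "rank_of_columns cs = dim (span (set cs))"

lemma rank_eq_rank_of_columns:
  fixes M :: "real^'c^'n" and e :: "nat \<Rightarrow> 'c"
  assumes e: "bij_betw e {..<length cs} UNIV"
    and cols: "\<And>k. k < length cs \<Longrightarrow> column (e k) M = cs ! k"
  shows "rank M = rank_of_columns cs"
proof -
  have "columns M = (\<lambda>j. column j M) ` e ` {..<length cs}"
    using e by (auto simp: columns_def bij_betw_def)
  also have "\<dots> = set cs"
    using cols by (auto simp: in_set_conv_nth image_image image_iff)
  finally show ?thesis
    by (simp add: column_rank_def rank_of_columns_def)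
qed

lemma vectorize_kron:
  "(B \<otimes>\<^sub>K A) *v vectorize M = vectorize (A ** M ** transpose B)"
  by (auto simp: vec_eq_iff kron_def vectorize_def matrix_vector_mult_def matrix_matrix_mult_def
      transpose_def sum_distrib_left sum_distrib_right sum.cartesian_product case_prod_unfold
      UNIV_Times_UNIV[symmetric] mult_ac simp del: UNIV_Times_UNIV)

lemma DIM_parameter_space:
  "DIM((real^'d) \<times> (real^'d^'d) \<times> (real^'d^'d^'m))
    = CARD('d) + (CARD('m) + 1) * CARD('d)\<^sup>2"
  by (simp add: power2_eq_square algebra_simps)

end

theory Submission imports Defs
begin

text \<open>
  The entries of both families of Krylov vectors are polynomials in the entries of
  \<open>(x0, A, G)\<close>. Two general facts reduce the claim to finding one good parameter.
  The zero set of a real polynomial function that does not vanish identically is negligible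
  (\<open>negligible_zeros_real_polynomial_function\<close>). Hence, if \<open>r\<close> vectors depend
  polynomially on a parameter and are linearly independent at one parameter, then they span a
  space of dimension \<open>r\<close> at almost every parameter (\<open>negligible_rank_drop\<close>). The
  determinant that certifies this comes from extending the vectors at the good parameter to a basis.

  The good parameter is the vector \<open>x0\<close> of ones, a diagonal matrix \<open>A\<close> with entries
  \<open>a i\<close>, and \<open>G = 0\<close>. The lifted matrix is then diagonal with entries
  \<open>a i + a j\<close>, and the vectorized outer product again consists of ones. The Krylov vectors of
  a diagonal matrix and the vector of ones are the Vandermonde columns of its diagonal, so as many of
  them are independent as there are distinct diagonal entries (\<open>independent_power_vectors\<close>).
  If the \<open>a i\<close> are distinct powers of two, then \<open>a i + a j\<close> determines the unordered pair
  \<open>{i, j}\<close> (\<open>sum_two_powers_eq\<close>), which gives \<open>d\<close> and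
  \<open>d * (d + 1) / 2\<close> distinct entries, respectively. These are also the numbers of Krylov
  vectors, so no upper bound on the ranks is needed.
\<close>

section \<open>Zero sets of polynomial functions\<close>

text \<open>
  A line through \<open>p\<close> meets the zero set in finitely many points, because the restriction of
  \<open>f\<close> to it is a polynomial in one variable that is nonzero at the parameter \<open>0\<close>.
  By Fubini, for almost every \<open>t\<close> the preimage of the zero set under the dilation with centre
  \<open>p\<close> and factor \<open>t\<close> is a null set, and one \<open>t \<noteq> 0\<close> is enough.
\<close>

lemma negligible_zeros_real_polynomial_function:
  fixes f :: "'a::euclidean_space \<Rightarrow> real"
  assumes f: "real_polynomial_function f" and p: "f p \<noteq> 0"
  shows "negligible {x. f x = 0}"
proof -
  define h where "h = (\<lambda>t x. f (p + t *\<^sub>R (x - p)))"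
  have cont: "continuous_on UNIV f"
    using f by (simp add: continuous_at_imp_continuous_on continuous_real_polymonial_function)
  have lines: "finite {t. h t x = 0}" for x
  proof -
    have "polynomial_function (\<lambda>t::real. p + t *\<^sub>R (x - p))"
      by (intro polynomial_function_add polynomial_function_const polynomial_function_mult
            polynomial_function_id)
    from real_polynomial_function_compose[OF this f]
    have "real_polynomial_function (\<lambda>t. h t x)"
      by (simp add: h_def o_def)
    then obtain a n where a: "(\<lambda>t. h t x) = (\<lambda>t. \<Sum>i\<le>n. a i * t ^ i)"
      unfolding real_polynomial_function_iff_sum by blast
    have "(\<Sum>i\<le>n. a i * 0 ^ i) \<noteq> 0"
      using fun_cong[OF a, of 0] p by (simp add: h_def)
    then have "\<exists>i\<le>n. a i \<noteq> 0"
      by (metis (no_types, lifting) atMost_iff mult_zero_left sum.neutral)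
    then show ?thesis
      using fun_cong[OF a] polyfun_finite_roots[of a n] by simp
  qed
  have "AE x in lborel. AE t in lborel. h t x \<noteq> 0"
  proof (rule AE_I2)
    fix x
    have "{t. h t x = 0} \<in> null_sets lborel"
      using lines[of x] by (rule finite_imp_null_set_lborel)
    then show "AE t in lborel. h t x \<noteq> 0"
      by (rule AE_I'[where N="{t. h t x = 0}"]) auto
  qed
  moreover have "{x \<in> space (lborel \<Otimes>\<^sub>M lborel). h (snd x) (fst x) \<noteq> 0} \<in> sets (lborel \<Otimes>\<^sub>M lborel :: ('a \<times> real) measure)"
  proof -
    have "continuous_on UNIV (\<lambda>x. h (snd x) (fst x))"
      unfolding h_def
      by (intro continuous_on_compose2[OF cont] continuous_intros) auto
    then have "open {x. h (snd x) (fst x) \<noteq> 0}"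
      by (intro open_Collect_neq continuous_intros)
    then have "{x. h (snd x) (fst x) \<noteq> 0} \<in> sets (borel :: ('a \<times> real) measure)"
      by (rule borel_open)
    then show ?thesis
      by (simp add: space_pair_measure flip: borel_prod)
  qed
  ultimately have "AE t in lborel. AE x in lborel. h t x \<noteq> 0"
    using lborel_pair.AE_commute[of "\<lambda>x t. h t x \<noteq> 0"] by auto
  moreover have "AE t in lborel. (t::real) \<noteq> 0"
    by (rule AE_lborel_singleton)
  ultimately have "AE t in lborel. t \<noteq> 0 \<and> (AE x in lborel. h t x \<noteq> 0)"
    by eventually_elim auto
  then have "\<exists>t. t \<noteq> 0 \<and> (AE x in lborel. h t x \<noteq> 0)"
    by (rule eventually_happens'[rotated]) (simp add: ae_filter_eq_bot_iff)
  then obtain t where t: "t \<noteq> 0" "AE x in lborel. h t x \<noteq> 0"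
    by blast
  from t(2) obtain N where "N \<in> null_sets lborel" "{x. h t x = 0} \<subseteq> N"
    unfolding eventually_ae_filter by auto
  then have "negligible {x. h t x = 0}"
    by (meson negligible_iff_null_sets negligible_subset null_sets_completionI)
  then have "negligible ((\<lambda>x. p + t *\<^sub>R (x - p)) ` {x. h t x = 0})"
    by (rule negligible_differentiable_image_negligible[OF order_refl])
       (auto intro!: differentiable_on_add differentiable_on_const differentiable_on_scaleR
          differentiable_on_diff differentiable_on_id)
  moreover have "{x. f x = 0} \<subseteq> (\<lambda>x. p + t *\<^sub>R (x - p)) ` {x. h t x = 0}"
  proof
    fix y assume "y \<in> {x. f x = 0}"
    then show "y \<in> (\<lambda>x. p + t *\<^sub>R (x - p)) ` {x. h t x = 0}"
      using t(1) by (intro image_eqI[of _ _ "p + (1 / t) *\<^sub>R (y - p)"]) (simp_all add: h_def)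
  qed
  ultimately show ?thesis
    by (rule negligible_subset)
qed


section \<open>Generic rank of vectors with polynomial entries\<close>

text \<open>
  The vectors at \<open>p0\<close> are extended to a basis \<open>B\<close>, and \<open>L p\<close> is the linear
  map that sends the \<open>k\<close>-th of them to its value at \<open>p\<close> and fixes the rest of
  \<open>B\<close>. Its determinant is a polynomial in \<open>p\<close> that equals \<open>1\<close> at
  \<open>p0\<close>, and where it does not vanish the vectors at \<open>p\<close> are independent.
\<close>
lemma negligible_rank_drop:
  fixes w :: "nat \<Rightarrow> 'a::euclidean_space \<Rightarrow> real^'n"
  assumes poly: "\<And>k i. k < r \<Longrightarrow> real_polynomial_function (\<lambda>p. w k p $ i)"
    and inj: "inj_on (\<lambda>k. w k p0) {..<r}"
    and indep: "independent ((\<lambda>k. w k p0) ` {..<r})"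
  shows "negligible {p. dim ((\<lambda>k. w k p) ` {..<r}) \<noteq> r}"
proof -
  define W where "W = (\<lambda>k. w k p0) ` {..<r}"
  obtain B where B: "W \<subseteq> B" "independent B" "span B = UNIV"
    using maximal_independent_subset_extend[of W UNIV] indep unfolding W_def
    by (metis top.extremum top.extremum_uniqueI)
  then have finB: "finite B"
    by (simp add: independent_imp_finite)
  define g where "g = (\<lambda>p b. if b \<in> W then w (the_inv_into {..<r} (\<lambda>k. w k p0) b) p else b)"
  have g_w: "g p (w k p0) = w k p" if "k < r" for p k
    using that the_inv_into_f_f[OF inj, of k] by (simp add: g_def W_def)
  have g_p0: "g p0 b = b" for b
    using g_w unfolding g_def W_def by auto
  define L where "L = (\<lambda>p. construct B (g p))"
  have lin: "linear (L p)" for p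
    unfolding L_def by (rule linear_construct[OF B(2)])
  have L_B: "L p b = g p b" if "b \<in> B" for p b
    unfolding L_def using that by (rule construct_basis[OF B(2)])
  have L_sum: "L p x = (\<Sum>b\<in>B. representation B x b *\<^sub>R g p b)" for p x
  proof -
    have "L p x = L p (\<Sum>b\<in>B. representation B x b *\<^sub>R b)"
      using B finB by (subst sum_representation_eq) auto
    also have "\<dots> = (\<Sum>b\<in>B. representation B x b *\<^sub>R g p b)"
      by (simp add: linear_sum[OF lin] linear_scale[OF lin] L_B)
    finally show ?thesis .
  qed
  have "L p0 = (\<lambda>x. x)"
    using B finB by (auto simp: L_sum g_p0 sum_representation_eq)
  then have "det (matrix (L p0)) \<noteq> 0"
    using det_nz_iff_inj[OF lin[of p0]] by simp
  moreover have g_poly: "real_polynomial_function (\<lambda>p. g p b $ i)" for b i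
    using poly g_w by (cases "b \<in> W") (auto simp: W_def, auto simp: g_def W_def)
  then have "real_polynomial_function (\<lambda>p. det (matrix (L p)))"
    unfolding det_def matrix_def L_sum
    by (auto intro!: real_polynomial_function_sum real_polynomial_function_prod
          real_polynomial_function.intros(2,4) simp: finB)
  ultimately have "negligible {p. det (matrix (L p)) = 0}"
    by (rule negligible_zeros_real_polynomial_function[rotated])
  moreover have "dim ((\<lambda>k. w k p) ` {..<r}) = r" if "det (matrix (L p)) \<noteq> 0" for p
  proof -
    have "inj (L p)"
      using that det_nz_iff_inj[OF lin] by blast
    then have "dim (L p ` W) = dim W"
      by (intro dim_image_eq lin) (auto intro: inj_on_subset)
    also have "dim W = r"
      using indep inj by (simp add: W_def dim_eq_card_independent card_image)
    also have "L p ` W = (\<lambda>k. w k p) ` {..<r}"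
      using B(1) by (auto simp: W_def image_image L_B g_w intro!: image_cong)
    finally show ?thesis .
  qed
  ultimately show ?thesis
    by (elim negligible_subset) auto
qed

section \<open>Krylov vectors of diagonal matrices\<close>

lemma independent_familyI:
  fixes w :: "'i \<Rightarrow> 'a::real_vector"
  assumes fin: "finite I"
    and zero: "\<And>c k. (\<Sum>k\<in>I. c k *\<^sub>R w k) = 0 \<Longrightarrow> k \<in> I \<Longrightarrow> c k = 0"
  shows "inj_on w I" and "independent (w ` I)"
proof -
  show inj: "inj_on w I"
  proof (rule inj_onI, rule ccontr)
    fix j k assume jk: "j \<in> I" "k \<in> I" "w j = w k" "j \<noteq> k"
    \<comment> \<open>Equal vectors at two indices satisfy the relation with coefficients \<open>1\<close> and \<open>-1\<close>.\<close>
    have "(\<Sum>l\<in>I. (of_bool (l = j) - of_bool (l = k)) *\<^sub>R w l) = 0"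
      using jk fin by (simp add: scaleR_left_diff_distrib sum_subtractf if_distrib[of "\<lambda>c. c *\<^sub>R _"] of_bool_def cong: if_cong)
    from zero[OF this jk(1)] jk(4) show False by simp
  qed
  show "independent (w ` I)"
  proof (rule independent_if_scalars_zero)
    fix f x assume "(\<Sum>x\<in>w ` I. f x *\<^sub>R x) = 0" "x \<in> w ` I"
    then show "f x = 0"
      using zero[of "\<lambda>k. f (w k)"] by (auto simp: sum.reindex[OF inj])
  qed (simp add: fin)
qed

text \<open>
  This is the rank of a Vandermonde matrix: a linear relation between the vectors is a polynomial of
  degree less than \<open>r\<close> that has all values of \<open>b\<close> as roots.
\<close>
lemma independent_power_vectors:
  fixes b :: "'n::finite \<Rightarrow> real"
  assumes card: "r \<le> card (range b)"
  shows "inj_on (\<lambda>k. \<chi> i. b i ^ k) {..<r}"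
    and "independent ((\<lambda>k. \<chi> i. b i ^ k) ` {..<r})"
proof -
  have "c k = 0" if 0: "(\<Sum>k<r. c k *\<^sub>R (\<chi> i. b i ^ k)) = 0" and k: "k \<in> {..<r}" for c k
  proof (rule ccontr)
    assume "c k \<noteq> 0"
    moreover have n: "{..<r} = {..r - 1}" "k \<le> r - 1"
      using k by auto
    ultimately have roots: "finite {z. (\<Sum>j\<le>r - 1. c j * z ^ j) = 0}"
      "card {z. (\<Sum>j\<le>r - 1. c j * z ^ j) = 0} \<le> r - 1"
      using polyfun_rootbound[of "r - 1" c] by blast+
    have "range b \<subseteq> {z. (\<Sum>j\<le>r - 1. c j * z ^ j) = 0}"
      using 0 by (auto simp: vec_eq_iff n(1))
    then have "card (range b) \<le> r - 1"
      using roots card_mono le_trans by blast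
    with card k show False by simp
  qed
  then show "inj_on (\<lambda>k. \<chi> i. b i ^ k) {..<r}" "independent ((\<lambda>k. \<chi> i. b i ^ k) ` {..<r})"
    using independent_familyI[of "{..<r}" "\<lambda>k. \<chi> i. b i ^ k"] by auto
qed

lemma set_krylov: "set (krylov B w r) = (\<lambda>k. mat_pow B k *v w) ` {..<Suc r}"
  unfolding krylov_def by (simp only: set_map set_upt atLeast0LessThan)

lemma mat_pow_Suc_mult_vec: "mat_pow B (Suc k) *v w = B *v (mat_pow B k *v w)"
  by (simp add: matrix_vector_mul_assoc)

text \<open>The diagonal matrix with the given diagonal.\<close>
definition diag_mat :: "('n \<Rightarrow> real) \<Rightarrow> real^'n^'n" where
  "diag_mat b = (\<chi> i j. if i = j then b i else 0)"

text \<open>The constant \<open>1\<close> of a vector type is the vector of ones.\<close>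
lemma mat_pow_diag_mat_ones: "mat_pow (diag_mat b) k *v 1 = (\<chi> i. b i ^ k)"
proof (induction k)
  case (Suc k)
  then show ?case
    unfolding mat_pow_Suc_mult_vec
    by (simp add: vec_eq_iff matrix_vector_mult_def diag_mat_def
          if_distrib[of "\<lambda>c. c * _"] cong: if_cong)
qed (simp add: vec_eq_iff)

lemma negligible_krylov_rank_drop:
  fixes B :: "'a::euclidean_space \<Rightarrow> real^'n^'n" and v :: "'a \<Rightarrow> real^'n"
  assumes B: "\<And>i j. real_polynomial_function (\<lambda>p. B p $ i $ j)"
    and v: "\<And>i. real_polynomial_function (\<lambda>p. v p $ i)"
    and p0: "B p0 = diag_mat b" "v p0 = 1"
    and card: "r < card (range b)"
  shows "negligible {p. rank_of_columns (krylov (B p) (v p) r) \<noteq> Suc r}"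
proof -
  have poly: "real_polynomial_function (\<lambda>p. (mat_pow (B p) k *v v p) $ i)" for k i
  proof (induction k arbitrary: i)
    case (Suc k)
    have "real_polynomial_function (\<lambda>p. \<Sum>j\<in>UNIV. B p $ i $ j * (mat_pow (B p) k *v v p) $ j)"
      by (intro real_polynomial_function_sum real_polynomial_function.intros(4) B Suc) simp
    then show ?case
      unfolding mat_pow_Suc_mult_vec by (simp add: matrix_vector_mult_def)
  qed (simp add: v)
  show ?thesis
    using negligible_rank_drop[where w = "\<lambda>k p. mat_pow (B p) k *v v p" and r = "Suc r" and ?p0.0 = p0]
      independent_power_vectors[of "Suc r" b] poly card
    by (simp add: rank_of_columns_def set_krylov p0 mat_pow_diag_mat_ones del: lessThan_Suc mat_pow.simps)
qed

section \<open>Diagonal entries with distinct pairwise sums\<close>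

lemma sum_two_powers_eq:
  fixes i j k l :: nat
  assumes eq: "(2::nat) ^ i + 2 ^ j = 2 ^ k + 2 ^ l" and "i \<le> j" "k \<le> l"
  shows "i = k \<and> j = l"
proof -
  have less: "(2::nat) ^ i + 2 ^ j < 2 ^ k + 2 ^ l" if "i \<le> j" "j < l" for i j k l :: nat
  proof -
    have "(2::nat) ^ i + 2 ^ j \<le> 2 ^ Suc j"
      using that by simp
    also have "\<dots> \<le> 2 ^ l"
      using that by (intro power_increasing) auto
    finally show ?thesis
      by (rule le_less_trans) simp
  qed
  have "j = l"
    using less[of i j l k] less[of k l j i] assms by (metis nat_neq_iff)
  with eq show ?thesis by simp
qed

lemma card_ordered_pairs_le: "card (SIGMA j:{..<n::nat}. {..j}) = (n\<^sup>2 + n) div 2"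
proof -
  have "2 * (\<Sum>j<n. Suc j) = n\<^sup>2 + n"
    by (induction n) (auto simp: power2_eq_square)
  then show ?thesis by simp
qed

lemma exists_distinct_pair_sums:
  obtains a :: "'d::finite \<Rightarrow> real"
  where "inj a" "(CARD('d)\<^sup>2 + CARD('d)) div 2 \<le> card (range (\<lambda>p. a (fst p) + a (snd p)))"
proof -
  let ?d = "CARD('d)"
  obtain e :: "'d \<Rightarrow> nat" where "bij_betw e UNIV {0..<?d}"
    using ex_bij_betw_finite_nat[of "UNIV :: 'd set"] by auto
  then have e: "inj e" "range e = {..<?d}"
    by (auto simp: bij_betw_def)
  define a where "a = (\<lambda>i. 2 ^ e i :: real)"
  define s where "s = (\<lambda>(j, i). 2 ^ i + 2 ^ j :: real)"
  have "inj a"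
    using e(1) by (auto simp: a_def inj_def)
  moreover have "inj_on s (SIGMA j:{..<?d}. {..j})"
  proof (rule inj_onI, clarsimp simp: s_def)
    fix j i l k :: nat assume *: "i \<le> j" "k \<le> l" and "(2::real) ^ i + 2 ^ j = 2 ^ k + 2 ^ l"
    then have "real (2 ^ i + 2 ^ j) = real (2 ^ k + 2 ^ l)" by simp
    then have "(2::nat) ^ i + 2 ^ j = 2 ^ k + 2 ^ l" by (simp only: of_nat_eq_iff)
    with * sum_two_powers_eq show "j = l \<and> i = k" by blast
  qed
  then have "card (s ` (SIGMA j:{..<?d}. {..j})) = (?d\<^sup>2 + ?d) div 2"
    by (simp only: card_image card_ordered_pairs_le)
  moreover have "s ` (SIGMA j:{..<?d}. {..j}) \<subseteq> range (\<lambda>p. a (fst p) + a (snd p))"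
  proof clarify
    fix j i :: nat assume "j < ?d" "i \<le> j"
    then have "i \<in> range e" "j \<in> range e"
      using e(2) by auto
    then obtain i' j' where "i = e i'" "j = e j'"
      by blast
    then show "s (j, i) \<in> range (\<lambda>p. a (fst p) + a (snd p))"
      by (intro range_eqI[of _ _ "(i', j')"]) (simp add: s_def a_def)
  qed
  ultimately show ?thesis
    by (intro that[of a]) (auto simp flip: card_mono intro: card_mono[THEN le_trans[rotated]])
qed

section \<open>The lifted system\<close>

lemma lifted_mat_nth:
  "lifted_mat A G $ r $ c
    = A $ fst r $ fst c * of_bool (snd r = snd c) + of_bool (fst r = fst c) * A $ snd r $ snd c
      + (\<Sum>k\<in>UNIV. G $ k $ fst r $ fst c * G $ k $ snd r $ snd c)"
  by (simp add: lifted_mat_def kron_sum_def kron_def mat_def of_bool_def)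

lemma vectorize_outer_nth: "vectorize (outer x y) $ p = x $ snd p * y $ fst p"
  by (simp add: vectorize_def outer_def matrix_matrix_mult_def columnvector_def rowvector_def)

lemma lifted_mat_diag_mat:
  "lifted_mat (diag_mat a) (0 :: real^'d^'d^'m) = diag_mat (\<lambda>p. a (fst p) + a (snd p))"
  by (auto simp: vec_eq_iff lifted_mat_nth diag_mat_def prod_eq_iff)

theorem propositionB1:
  shows "{(x0 :: real^'d, A :: real^'d^'d, G :: real^'d^'d^'m).
            rank_of_columns (krylov A x0 (CARD('d) - 1)) \<noteq> CARD('d)
          \<or> rank_of_columns (krylov (lifted_mat A G) (vectorize (outer x0 x0))
                ((CARD('d)\<^sup>2 + CARD('d) - 2) div 2))
              \<noteq> (CARD('d)\<^sup>2 + CARD('d)) div 2}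
         \<in> null_sets lebesgue"
proof -
  let ?d = "CARD('d)"
  obtain a :: "'d \<Rightarrow> real" where a: "inj a"
    "(?d\<^sup>2 + ?d) div 2 \<le> card (range (\<lambda>p. a (fst p) + a (snd p)))"
    by (rule exists_distinct_pair_sums)
  define p0 :: "(real^'d) \<times> (real^'d^'d) \<times> (real^'d^'d^'m)" where "p0 = (1, diag_mat a, 0)"
  have d: "Suc (?d - 1) = ?d" "Suc ((?d\<^sup>2 + ?d - 2) div 2) = (?d\<^sup>2 + ?d) div 2"
  proof -
    have "0 < ?d" by simp
    then obtain n where "?d = Suc n" using gr0_implies_Suc by blast
    then show "Suc (?d - 1) = ?d" "Suc ((?d\<^sup>2 + ?d - 2) div 2) = (?d\<^sup>2 + ?d) div 2"
      by (simp_all add: power2_eq_square)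
  qed
  have coord: "real_polynomial_function (\<lambda>p :: (real^'d) \<times> (real^'d^'d) \<times> (real^'d^'d^'m). fst p $ i)"
    "real_polynomial_function (\<lambda>p :: (real^'d) \<times> (real^'d^'d) \<times> (real^'d^'d^'m). fst (snd p) $ i $ j)"
    "real_polynomial_function (\<lambda>p :: (real^'d) \<times> (real^'d^'d) \<times> (real^'d^'d^'m). snd (snd p) $ k $ i $ j)"
    for i j k
    by (intro real_polynomial_function.intros(1) bounded_linear_intros
          bounded_linear_compose[OF bounded_linear_vec_nth] bounded_linear_fst bounded_linear_snd
          bounded_linear_compose[OF bounded_linear_fst] bounded_linear_compose[OF bounded_linear_snd])+
  have "negligible {p :: (real^'d) \<times> (real^'d^'d) \<times> (real^'d^'d^'m).
      rank_of_columns (krylov (fst (snd p)) (fst p) (?d - 1)) \<noteq> Suc (?d - 1)}"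
    by (rule negligible_krylov_rank_drop[where ?p0.0 = p0 and b = a])
       (use a(1) in \<open>simp_all add: p0_def coord card_image\<close>)
  moreover have "negligible {p :: (real^'d) \<times> (real^'d^'d) \<times> (real^'d^'d^'m).
      rank_of_columns (krylov (lifted_mat (fst (snd p)) (snd (snd p)))
        (vectorize (outer (fst p) (fst p))) ((?d\<^sup>2 + ?d - 2) div 2)) \<noteq> Suc ((?d\<^sup>2 + ?d - 2) div 2)}"
  proof (rule negligible_krylov_rank_drop[where ?p0.0 = p0])
    show "lifted_mat (fst (snd p0)) (snd (snd p0)) = diag_mat (\<lambda>p. a (fst p) + a (snd p))"
      by (simp add: p0_def lifted_mat_diag_mat)
    show "(?d\<^sup>2 + ?d - 2) div 2 < card (range (\<lambda>p. a (fst p) + a (snd p)))"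
      using a(2) d(2) by linarith
    show "real_polynomial_function (\<lambda>p :: (real^'d) \<times> (real^'d^'d) \<times> (real^'d^'d^'m).
        lifted_mat (fst (snd p)) (snd (snd p)) $ r $ c)" for r c
      unfolding lifted_mat_nth
      by (intro real_polynomial_function.intros(2-4) real_polynomial_function_sum coord) simp
    show "real_polynomial_function (\<lambda>p :: (real^'d) \<times> (real^'d^'d) \<times> (real^'d^'d^'m).
        vectorize (outer (fst p) (fst p)) $ q)" for q
      unfolding vectorize_outer_nth by (intro real_polynomial_function.intros(4) coord)
    show "vectorize (outer (fst p0) (fst p0)) = 1"
      by (simp add: vec_eq_iff vectorize_outer_nth p0_def)
  qed
  ultimately show ?thesis
    unfolding negligible_iff_null_sets[symmetric] d
    by (rule negligible_subset[OF negligible_Un]) auto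
qed

end
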